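(* The automorphism group $\mathrm{Aut}(\mathcal{C}_6)$ of the Hexacode acts transitively on the set of vectors of weight $2$ in $K^6$.
   Context: Let $K=\{0,a,b,c\}$ be the Kleinian four-group; $\mathrm{wt}(\mathbf{x})$ is the number of nonzero coordinates of $\mathbf{x}\in K^6$. The Hexacode $\mathcal{C}_6$ is the subgroup of $K^6$ generated by $(a,0,a,0,b,b)$, $(a,0,b,b,a,0)$, $(b,b,a,0,a,0)$, $(0,0,a,a,a,a)$, $(a,a,0,0,a,a)$, $(b,0,b,0,c,a)$. The group $G=S_3^6\rtimes S_6$ acts on $K^6$ by permuting the coordinates and independently permuting the three nonzero symbols $a,b,c$ in each coordinate, and $\mathrm{Aut}(\mathcal{C}_6)=\{g\in G: g\,\mathcal{C}_6=\mathcal{C}_6\}$. *)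

theory Defs
  imports
    "HOL-Analysis.Cartesian_Space"
    "HOL-Algebra.Group_Action"
    "HOL-Combinatorics.Permutations"
    "HOL-Computational_Algebra.Group_Closure"
begin

datatype klein = k0 | ka | kb | kc

instantiation klein :: ab_group_add
begin

definition zero_klein :: klein where
  "0 = k0"

fun plus_klein :: "klein \<Rightarrow> klein \<Rightarrow> klein" where
  "k0 + y = y"
| "x + k0 = x"
| "ka + ka = k0"
| "ka + kb = kc"
| "ka + kc = kb"
| "kb + ka = kc"
| "kb + kb = k0"
| "kb + kc = ka"
| "kc + ka = kb"
| "kc + kb = ka"
| "kc + kc = k0"

definition uminus_klein :: "klein \<Rightarrow> klein" where
  "- x = (x :: klein)"

definition minus_klein :: "klein \<Rightarrow> klein \<Rightarrow> klein" where
  "x - y = x + (y :: klein)"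

instance
proof
  fix x y z :: klein
  show "x + y + z = x + (y + z)" by (cases x; cases y; cases z) simp_all
  show "x + y = y + x" by (cases x; cases y) simp_all
  show "0 + x = x" by (simp add: zero_klein_def)
  show "- x + x = 0" by (cases x) (simp_all add: zero_klein_def uminus_klein_def)
  show "x - y = x + - y" by (simp add: minus_klein_def uminus_klein_def)
qed

end

definition weight :: "klein ^ 6 \<Rightarrow> nat" where
  "weight x = card {i. x $ i \<noteq> 0}"

(* The coordinates are indexed by the six-element type 6, in the order 1, ..., 6 (where 6 = 0). *)
lemma vector_6 [simp]:
  fixes x1 x2 x3 x4 x5 x6 :: "'a :: zero"
  defines "v \<equiv> vector [x1, x2, x3, x4, x5, x6] :: 'a ^ 6"
  shows "v $ 1 = x1" "v $ 2 = x2" "v $ 3 = x3" "v $ 4 = x4" "v $ 5 = x5" "v $ 6 = x6"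
  by (simp_all add: v_def vector_def)

definition hexacode :: "(klein ^ 6) set" where
  "hexacode = group_closure
     {vector [ka, k0, ka, k0, kb, kb],
      vector [ka, k0, kb, kb, ka, k0],
      vector [kb, kb, ka, k0, ka, k0],
      vector [k0, k0, ka, ka, ka, ka],
      vector [ka, ka, k0, k0, ka, ka],
      vector [kb, k0, kb, k0, kc, ka]}"

(* A pair (s, p) first moves the entry in position i to position p i and then applies the
   symbol permutation s j to the entry now in position j. *)
fun act :: "(6 \<Rightarrow> klein \<Rightarrow> klein) \<times> (6 \<Rightarrow> 6) \<Rightarrow> klein ^ 6 \<Rightarrow> klein ^ 6" where
  "act (s, p) x = (\<chi> j. s j (x $ inv_into UNIV p j))"

(* The semidirect product of S_3^6 by S_6; its multiplication is the one making act a left action. *)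
definition symG :: "((6 \<Rightarrow> klein \<Rightarrow> klein) \<times> (6 \<Rightarrow> 6)) monoid" where
  "symG =
    \<lparr>carrier = {(s, p). (\<forall>j. s j permutes {ka, kb, kc}) \<and> p permutes UNIV},
     monoid.mult = (\<lambda>(s, p) (t, q). (\<lambda>j. s j \<circ> t (inv_into UNIV p j), p \<circ> q)),
     monoid.one = (\<lambda>j. id, id)\<rparr>"

lemma act_one: "act \<one>\<^bsub>symG\<^esub> x = x"
  by (simp add: symG_def vec_eq_iff)

lemma act_mult:
  assumes "g \<in> carrier symG" "h \<in> carrier symG"
  shows "act (g \<otimes>\<^bsub>symG\<^esub> h) x = act g (act h x)"
  using assms
  by (auto simp: symG_def vec_eq_iff o_inv_distrib permutes_bij)

lemma group_symG: "group symG"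
proof (rule groupI)
  fix g h assume "g \<in> carrier symG" "h \<in> carrier symG"
  then show "g \<otimes>\<^bsub>symG\<^esub> h \<in> carrier symG"
    by (auto simp: symG_def intro!: permutes_compose)
next
  show "\<one>\<^bsub>symG\<^esub> \<in> carrier symG"
    by (auto simp: symG_def permutes_id)
next
  fix g h k assume "g \<in> carrier symG" "h \<in> carrier symG" "k \<in> carrier symG"
  then show "g \<otimes>\<^bsub>symG\<^esub> h \<otimes>\<^bsub>symG\<^esub> k = g \<otimes>\<^bsub>symG\<^esub> (h \<otimes>\<^bsub>symG\<^esub> k)"
    by (auto simp: symG_def fun_eq_iff o_inv_distrib permutes_bij)
next
  fix g assume "g \<in> carrier symG"
  then show "\<one>\<^bsub>symG\<^esub> \<otimes>\<^bsub>symG\<^esub> g = g"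
    by (auto simp: symG_def)
next
  fix g assume g: "g \<in> carrier symG"
  obtain s p where [simp]: "g = (s, p)" by fastforce
  from g have s: "\<And>j. s j permutes {ka, kb, kc}" and p: "p permutes UNIV"
    by (auto simp: symG_def)
  have "(\<lambda>j. inv_into UNIV (s (p j)), inv_into UNIV p) \<in> carrier symG"
    using s p by (auto simp: symG_def permutes_inv)
  moreover have "(\<lambda>j. inv_into UNIV (s (p j)), inv_into UNIV p) \<otimes>\<^bsub>symG\<^esub> g = \<one>\<^bsub>symG\<^esub>"
    using p s by (auto simp: symG_def fun_eq_iff permutes_inverses(2)[OF s] permutes_inverses permutes_inv_inv)
  ultimately show "\<exists>h\<in>carrier symG. h \<otimes>\<^bsub>symG\<^esub> g = \<one>\<^bsub>symG\<^esub>" by blast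
qed

definition Aut_hexacode :: "((6 \<Rightarrow> klein \<Rightarrow> klein) \<times> (6 \<Rightarrow> 6)) monoid" where
  "Aut_hexacode = symG\<lparr>carrier := {g \<in> carrier symG. act g ` hexacode = hexacode}\<rparr>"

end

theory Submission
  imports Defs
begin

text \<open>
  The Hexacode is the graph of an additive map from the first three coordinates to the last three, so
  whether an element of \<open>G\<close> preserves it is a check on 64 words. For every \<open>j\<close> some automorphism
  induces the transposition of the positions 1 and \<open>j\<close>. As these transpositions generate \<open>S\<^sub>6\<close>, the
  support of a vector of weight 2 can be moved to the positions 1 and 2. There, a rotation of the
  symbols moves the first symbol to \<open>a\<close>; if the second is not \<open>a\<close>, a transposition of two of the other positions,
  acting on position 1 as the reflection \<open>(b c)\<close> and on position 2 as a suitable reflection,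
  moves it to \<open>a\<close>.
\<close>

section \<open>The Klein group and the six positions\<close>

lemma UNIV_klein: "(UNIV :: klein set) = {k0, ka, kb, kc}"
  using klein.exhaust by blast

instance klein :: finite
  by standard (simp add: UNIV_klein)

lemma all_klein: "(\<forall>u. P u) \<longleftrightarrow> P k0 \<and> P ka \<and> P kb \<and> P kc"
  by (metis klein.exhaust)

lemma inv_swap [simp]: "inv_into UNIV (Transposition.transpose i j) = Transposition.transpose i j"
  by (rule inv_unique_comp) simp_all

lemma exhaust_6:
  fixes i :: 6
  shows "i = 1 \<or> i = 2 \<or> i = 3 \<or> i = 4 \<or> i = 5 \<or> i = 6"
proof (induct i)
  case (of_int z)
  \<comment> \<open>Representatives run from 0 to 5, and 0 is the position written 6.\<close>
  then have "z = 0 \<or> z = 1 \<or> z = 2 \<or> z = 3 \<or> z = 4 \<or> z = 5" by auto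
  then show ?case by auto
qed

lemma forall_6: "(\<forall>i::6. P i) \<longleftrightarrow> P 1 \<and> P 2 \<and> P 3 \<and> P 4 \<and> P 5 \<and> P 6"
  by (metis exhaust_6)

section \<open>Symbol permutations, and the Hexacode as a graph\<close>

abbreviation "swap \<equiv> Transposition.transpose"

abbreviation fix_a :: "klein \<Rightarrow> klein" where "fix_a \<equiv> swap kb kc"
abbreviation fix_b :: "klein \<Rightarrow> klein" where "fix_b \<equiv> swap ka kc"
abbreviation fix_c :: "klein \<Rightarrow> klein" where "fix_c \<equiv> swap ka kb"
abbreviation rot :: "klein \<Rightarrow> klein" where "rot \<equiv> fix_c \<circ> fix_a"
abbreviation rot' :: "klein \<Rightarrow> klein" where "rot' \<equiv> fix_a \<circ> fix_c"

lemma symbol_permutes [simp]: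
  "fix_a permutes {ka, kb, kc}" "fix_b permutes {ka, kb, kc}" "fix_c permutes {ka, kb, kc}"
  "rot permutes {ka, kb, kc}" "rot' permutes {ka, kb, kc}"
  by (simp_all add: permutes_swap_id permutes_compose)

lemma symbol_apply:
  "fix_a k0 = k0" "fix_a ka = ka" "fix_a kb = kc" "fix_a kc = kb"
  "fix_b k0 = k0" "fix_b ka = kc" "fix_b kb = kb" "fix_b kc = ka"
  "fix_c k0 = k0" "fix_c ka = kb" "fix_c kb = ka" "fix_c kc = kc"
  by (simp_all add: Transposition.transpose_def)

text \<open>The sum of two distinct nonzero elements of K is the third one, so every permutation of
  the nonzero symbols is additive.\<close>

lemma symbol_add:
  "fix_a (u + v) = fix_a u + fix_a v" "fix_b (u + v) = fix_b u + fix_b v"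
  "fix_c (u + v) = fix_c u + fix_c v"
  by (cases u; cases v; simp add: symbol_apply)+

text \<open>The first three coordinates of the generators form a basis of K^3 over the two-element
  field, which forces these additive formulas for the last three. Some coefficients are reflections,
  hence no scalars of the four-element field; so all are written as symbol permutations.\<close>

definition codeword :: "klein \<Rightarrow> klein \<Rightarrow> klein \<Rightarrow> klein ^ 6" where
  "codeword u v w = vector [u, v, w,
     fix_a u + v + fix_a w, rot' u + fix_c v + w, fix_b u + rot v + fix_a w]"

lemma codeword_nth [simp]:
  "codeword u v w $ 1 = u" "codeword u v w $ 2 = v" "codeword u v w $ 3 = w"
  "codeword u v w $ 4 = fix_a u + v + fix_a w"
  "codeword u v w $ 5 = rot' u + fix_c v + w"
  "codeword u v w $ 6 = fix_b u + rot v + fix_a w"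
  by (simp_all add: codeword_def)

lemma codeword_add:
  "codeword u v w + codeword u' v' w' = codeword (u + u') (v + v') (w + w')"
  by (simp add: vec_eq_iff forall_6 symbol_add add_ac)

lemma hexacode_eq: "hexacode = {codeword u v w | u v w. True}" (is "_ = ?C")
proof
  have gens: "hexacode = group_closure {codeword ka k0 ka, codeword ka k0 kb,
      codeword kb kb ka, codeword k0 k0 ka, codeword ka ka k0, codeword kb k0 kb}"
    by (simp add: hexacode_def codeword_def symbol_apply)
  show "hexacode \<subseteq> ?C"
  proof
    fix x assume "x \<in> hexacode"
    then show "x \<in> ?C"
      unfolding gens
    proof (induction rule: group_closure.induct)
      case (base s)
      \<comment> \<open>The base case of the closure covers 0 besides the generators.\<close>
      have "codeword k0 k0 k0 = 0"
        by (simp add: vec_eq_iff forall_6 symbol_apply zero_klein_def)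
      then have "0 \<in> ?C" by (metis (mono_tags, lifting) mem_Collect_eq)
      with base show ?case by blast
    next
      case (diff s t)
      have "s - t = s + t"
        by (simp add: vec_eq_iff minus_klein_def)
      moreover obtain u v w u' v' w' where "s = codeword u v w" "t = codeword u' v' w'"
        using diff.IH by blast
      ultimately have "s - t = codeword (u + u') (v + v') (w + w')"
        by (simp only: codeword_add)
      then show ?case by blast
    qed
  qed
  have add: "codeword (u + u') (v + v') (w + w') \<in> hexacode"
    if "codeword u v w \<in> hexacode" "codeword u' v' w' \<in> hexacode" for u v w u' v' w'
    using that unfolding gens codeword_add[symmetric] by (rule group_closure_add)
  have gen: "codeword ka k0 ka \<in> hexacode" "codeword ka k0 kb \<in> hexacode"
      "codeword kb kb ka \<in> hexacode" "codeword k0 k0 ka \<in> hexacode"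
      "codeword ka ka k0 \<in> hexacode" "codeword kb k0 kb \<in> hexacode"
    unfolding gens by (rule group_closure.base; simp)+
  \<comment> \<open>Sums of generators isolate a and b in each of the first three coordinates; the
    other three follow along. Then c = a + b and 0 = a + a give every symbol.\<close>
  have a1: "codeword ka k0 k0 \<in> hexacode"
    using add[OF gen(1) gen(4)] by simp
  have b3: "codeword k0 k0 kb \<in> hexacode"
    using add[OF a1 gen(2)] by simp
  have b1: "codeword kb k0 k0 \<in> hexacode"
    using add[OF b3 gen(6)] by simp
  have a2: "codeword k0 ka k0 \<in> hexacode"
    using add[OF a1 gen(5)] by simp
  have b2: "codeword k0 kb k0 \<in> hexacode"
    using add[OF add[OF b1 gen(4)] gen(3)] by simp
  have parts: "codeword u k0 k0 \<in> hexacode" "codeword k0 u k0 \<in> hexacode"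
      "codeword k0 k0 u \<in> hexacode" for u
    using add[OF a1 a1] add[OF a1 b1] a1 b1 add[OF a2 b2] a2 b2 add[OF gen(4) b3] gen(4) b3
    by (cases u; simp)+
  show "?C \<subseteq> hexacode"
    using add[OF add[OF parts(1) parts(2)] parts(3)] by (auto simp flip: zero_klein_def)
qed

section \<open>The action on K^6 and the subgroup of automorphisms\<close>

lemma symG_fixes_0:
  assumes "(s, p) \<in> carrier symG"
  shows "s j u = 0 \<longleftrightarrow> u = 0"
proof -
  have s: "s j permutes {ka, kb, kc}"
    using assms by (simp add: symG_def)
  have "s j 0 = 0"
    using permutes_not_in[OF s] by (simp add: zero_klein_def)
  then show ?thesis
    by (metis s permutes_inj injD)
qed

text \<open>Symbol permutations fix 0, so the support is merely carried along by the permutation of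
  positions.\<close>

lemma act_weight:
  assumes "g \<in> carrier symG"
  shows "weight (act g x) = weight x"
proof -
  obtain s p where g: "g = (s, p)" by fastforce
  have p: "bij p"
    using assms by (auto simp: g symG_def permutes_bij)
  have "{i. act g x $ i \<noteq> 0} = {i. x $ inv_into UNIV p i \<noteq> 0}"
    using symG_fixes_0[of s p] assms by (simp add: g)
  also have "\<dots> = p ` {i. x $ i \<noteq> 0}"
  proof (intro equalityI subsetI)
    fix i assume "i \<in> {i. x $ inv_into UNIV p i \<noteq> 0}"
    then show "i \<in> p ` {i. x $ i \<noteq> 0}"
      using p by (intro image_eqI[of _ _ "inv_into UNIV p i"]) (auto simp: bij_is_surj surj_f_inv_f)
  qed (use p in \<open>auto simp: bij_is_inj\<close>)
  finally show ?thesis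
    by (simp add: weight_def card_image[OF inj_on_subset[OF bij_is_inj[OF p] subset_UNIV]])
qed

lemma act_inv:
  assumes "g \<in> carrier symG"
  shows "act (inv\<^bsub>symG\<^esub> g) (act g x) = x"
proof -
  interpret group symG by (rule group_symG)
  show ?thesis
    using assms by (simp add: act_one flip: act_mult del: act.simps)
qed

lemma subgroup_Aut_hexacode: "subgroup (carrier Aut_hexacode) symG"
proof -
  interpret group symG by (rule group_symG)
  show ?thesis
  proof (rule subgroupI)
    show "carrier Aut_hexacode \<subseteq> carrier symG"
      by (auto simp: Aut_hexacode_def)
    show "carrier Aut_hexacode \<noteq> {}"
    proof -
      have "\<one>\<^bsub>symG\<^esub> \<in> carrier Aut_hexacode"
        using one_closed by (simp add: Aut_hexacode_def act_one del: act.simps)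
      then show ?thesis by blast
    qed
  next
    fix g assume "g \<in> carrier Aut_hexacode"
    then have g: "g \<in> carrier symG" "act g ` hexacode = hexacode"
      by (auto simp: Aut_hexacode_def)
    have "act (inv\<^bsub>symG\<^esub> g) ` act g ` hexacode = hexacode"
      by (simp add: image_image act_inv g(1))
    then have "act (inv\<^bsub>symG\<^esub> g) ` hexacode = hexacode"
      by (simp only: g(2))
    then show "inv\<^bsub>symG\<^esub> g \<in> carrier Aut_hexacode"
      using g by (simp add: Aut_hexacode_def)
  next
    fix g h assume "g \<in> carrier Aut_hexacode" "h \<in> carrier Aut_hexacode"
    then show "g \<otimes>\<^bsub>symG\<^esub> h \<in> carrier Aut_hexacode"
      by (simp add: Aut_hexacode_def act_mult image_image[symmetric, of "act g" "act h"])
  qed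
qed

section \<open>A criterion for automorphisms, and explicit ones\<close>

lemma Aut_hexacodeI:
  assumes "\<And>j. s j permutes {ka, kb, kc}" "p permutes UNIV"
    and "\<And>u v w. act (s, p) (codeword u v w) \<in> hexacode"
  shows "(s, p) \<in> carrier Aut_hexacode"
proof -
  have g: "(s, p) \<in> carrier symG"
    using assms by (simp add: symG_def)
  have "inj (act (s, p))"
    by (rule inj_on_inverseI) (rule act_inv[OF g])
  moreover have "act (s, p) ` hexacode \<subseteq> hexacode"
    using assms(3) by (auto simp: hexacode_eq simp del: act.simps)
  \<comment> \<open>An injective map of a finite set into itself is onto.\<close>
  ultimately have "act (s, p) ` hexacode = hexacode"
    by (metis endo_inj_surj finite inj_on_subset subset_UNIV)
  with g show ?thesis by (simp add: Aut_hexacode_def)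
qed

text \<open>As \<open>act\<close> moves entries first, the j-th argument acts on the entry that has
  arrived at position j. The default \<open>f6\<close> serves position 6.\<close>

definition coords :: "'a \<Rightarrow> 'a \<Rightarrow> 'a \<Rightarrow> 'a \<Rightarrow> 'a \<Rightarrow> 'a \<Rightarrow> 6 \<Rightarrow> 'a" where
  "coords f1 f2 f3 f4 f5 f6 = (\<lambda>_. f6)(1 := f1, 2 := f2, 3 := f3, 4 := f4, 5 := f5)"

lemma coords_simps [simp]:
  "coords f1 f2 f3 f4 f5 f6 1 = f1" "coords f1 f2 f3 f4 f5 f6 2 = f2"
  "coords f1 f2 f3 f4 f5 f6 3 = f3" "coords f1 f2 f3 f4 f5 f6 4 = f4"
  "coords f1 f2 f3 f4 f5 f6 5 = f5" "coords f1 f2 f3 f4 f5 f6 6 = f6"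
  by (simp_all add: coords_def)

lemma hexacode_iff: "x \<in> hexacode \<longleftrightarrow> x = codeword (x $ 1) (x $ 2) (x $ 3)"
  by (auto simp: hexacode_eq)

lemma coords_in_AutI:
  assumes "\<forall>f \<in> {f1, f2, f3, f4, f5, f6}. f permutes {ka, kb, kc}" "p permutes UNIV"
    and "\<forall>u v w. act (coords f1 f2 f3 f4 f5 f6, p) (codeword u v w) \<in> hexacode"
  shows "(coords f1 f2 f3 f4 f5 f6, p) \<in> carrier Aut_hexacode"
proof (rule Aut_hexacodeI)
  show "coords f1 f2 f3 f4 f5 f6 k permutes {ka, kb, kc}" for k
    using assms(1) exhaust_6[of k] by auto
qed (use assms in auto)

text \<open>Only transpositions of positions are unfolded; those of symbols stay folded for
  \<open>symbol_apply\<close>.\<close>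

lemmas in_hexacode = hexacode_iff vec_eq_iff forall_6 Transposition.transpose_def[where 'a = 6]

text \<open>To be used with \<open>simp only\<close>: on the 64 instances of a parity check the full simpset,
  with its arithmetic simprocs, is far too slow.\<close>

lemmas klein_eval = all_klein symbol_apply plus_klein.simps o_apply id_apply simp_thms klein.distinct

lemma swap_12_in_Aut:
  "(coords id id fix_a fix_a fix_a fix_a, swap 1 2) \<in> carrier Aut_hexacode"
  by (rule coords_in_AutI,
      simp_all add: permutes_swap_id permutes_id in_hexacode,
      simp only: klein_eval)

lemma swap_13_in_Aut:
  "(coords fix_a fix_a fix_a fix_a fix_b fix_b, swap 1 3) \<in> carrier Aut_hexacode"
  by (rule coords_in_AutI,
      simp_all add: permutes_swap_id permutes_id in_hexacode,
      simp only: klein_eval)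

lemma swap_14_in_Aut:
  "(coords id fix_a fix_a id fix_c fix_c, swap 1 4) \<in> carrier Aut_hexacode"
  by (rule coords_in_AutI,
      simp_all add: permutes_swap_id permutes_id in_hexacode,
      simp only: klein_eval)

lemma swap_15_in_Aut:
  "(coords fix_a fix_a fix_b fix_b fix_a fix_a, swap 1 5) \<in> carrier Aut_hexacode"
  by (rule coords_in_AutI,
      simp_all add: permutes_swap_id permutes_id in_hexacode,
      simp only: klein_eval)

lemma swap_16_in_Aut:
  "(coords id fix_a fix_c fix_c fix_a id, swap 1 6) \<in> carrier Aut_hexacode"
  by (rule coords_in_AutI,
      simp_all add: permutes_swap_id permutes_id in_hexacode,
      simp only: klein_eval)

text \<open>Used on positions 1 and 2, which stay in place: a is fixed in the first, b becomes a in
  the second.\<close>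

lemma swap_35_in_Aut:
  "(coords fix_a fix_c fix_c fix_b fix_c fix_b, swap 3 5) \<in> carrier Aut_hexacode"
  by (rule coords_in_AutI,
      simp_all add: permutes_swap_id permutes_id in_hexacode,
      simp only: klein_eval)

text \<open>The companion for c, which becomes a in position 2 while a in position 1 is
  fixed.\<close>

lemma swap_36_in_Aut:
  "(coords fix_a fix_b rot' fix_c fix_b rot, swap 3 6) \<in> carrier Aut_hexacode"
  by (rule coords_in_AutI,
      simp_all add: permutes_swap_id permutes_id in_hexacode,
      simp only: klein_eval)

text \<open>This is a scalar multiplication of order 3 for a structure of K^6 over the four-element
  field, conjugated in the even positions.\<close>

lemma rotation_in_Aut:
  "(coords rot rot' rot rot' rot rot', id) \<in> carrier Aut_hexacode"
  by (rule coords_in_AutI,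
      simp_all add: permutes_swap_id permutes_id in_hexacode,
      simp only: klein_eval)

section \<open>Vectors of weight 2 and their orbits\<close>

definition two :: "6 \<Rightarrow> klein \<Rightarrow> 6 \<Rightarrow> klein \<Rightarrow> klein ^ 6" where
  "two i u j v = (\<chi> k. if k = i then u else if k = j then v else 0)"

lemma weight_2E:
  assumes "weight x = 2"
  obtains i u j v where "i \<noteq> j" "u \<noteq> 0" "v \<noteq> 0" "x = two i u j v"
proof -
  obtain i j where "i \<noteq> j" and ij: "{k. x $ k \<noteq> 0} = {i, j}"
    using assms by (auto simp: weight_def card_2_iff)
  moreover have "x = two i (x $ i) j (x $ j)"
    using ij by (auto simp: two_def vec_eq_iff)
  ultimately show thesis
    using that[of i j "x $ i" "x $ j"] by blast
qed

lemma act_two: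
  assumes "(s, p) \<in> carrier symG"
  shows "act (s, p) (two i u j v) = two (p i) (s (p i) u) (p j) (s (p j) v)"
proof -
  have "inv_into UNIV p k = l \<longleftrightarrow> k = p l" for k l
    using assms permutes_inv_eq[of p UNIV k l] by (auto simp: symG_def)
  then show ?thesis
    using symG_fixes_0[OF assms] by (auto simp: two_def vec_eq_iff)
qed

definition same_orbit :: "klein ^ 6 \<Rightarrow> klein ^ 6 \<Rightarrow> bool" where
  "same_orbit x y \<longleftrightarrow> (\<exists>g \<in> carrier Aut_hexacode. act g x = y)"

lemma Aut_hexacode_symG: "g \<in> carrier Aut_hexacode \<Longrightarrow> g \<in> carrier symG"
  by (simp add: Aut_hexacode_def)

lemma same_orbit_refl: "same_orbit x x"
  unfolding same_orbit_def using subgroup.one_closed[OF subgroup_Aut_hexacode] act_one by blast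

lemma same_orbit_trans:
  assumes "same_orbit x y" "same_orbit y z"
  shows "same_orbit x z"
  using assms unfolding same_orbit_def
  by (metis Aut_hexacode_symG act_mult subgroup.m_closed[OF subgroup_Aut_hexacode])

lemma same_orbit_sym:
  assumes "same_orbit x y"
  shows "same_orbit y x"
  using assms unfolding same_orbit_def
  by (metis Aut_hexacode_symG act_inv subgroup.m_inv_closed[OF subgroup_Aut_hexacode])

lemma same_orbit_two:
  assumes "(s, p) \<in> carrier Aut_hexacode"
  shows "same_orbit (two i u j v) (two (p i) (s (p i) u) (p j) (s (p j) v))"
  unfolding same_orbit_def using assms act_two Aut_hexacode_symG by blast

lemma ex_transposition_in_Aut: "\<exists>s. (s, swap 1 k) \<in> carrier Aut_hexacode"
proof -
  \<comment> \<open>The unit covers k = 1, where the transposition is trivial.\<close>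
  have "(\<lambda>j. id, id) \<in> carrier Aut_hexacode"
    using subgroup.one_closed[OF subgroup_Aut_hexacode] by (simp add: symG_def)
  then show ?thesis
    using exhaust_6[of k] swap_12_in_Aut swap_13_in_Aut
      swap_14_in_Aut swap_15_in_Aut swap_16_in_Aut by auto
qed

text \<open>The resulting symbols are left open, because only the support matters until it is {1,
  2}.\<close>

lemma same_orbit_move:
  assumes "u \<noteq> 0" "v \<noteq> 0"
  obtains u' v' where "u' \<noteq> 0" "v' \<noteq> 0"
    "same_orbit (two i u j v) (two (swap 1 k i) u' (swap 1 k j) v')"
proof -
  obtain s where s: "(s, swap 1 k) \<in> carrier Aut_hexacode"
    using ex_transposition_in_Aut by blast
  show thesis
    using that same_orbit_two[OF s, of i u j v] symG_fixes_0[OF Aut_hexacode_symG[OF s]] assms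
    by metis
qed

text \<open>Three transpositions do it: j goes to 1, then on to 2, and finally the image of i goes
  to 1.\<close>

lemma same_orbit_support_12:
  assumes "i \<noteq> j" "u \<noteq> 0" "v \<noteq> 0"
  obtains u' v' where "u' \<noteq> 0" "v' \<noteq> 0" "same_orbit (two i u j v) (two 1 u' 2 v')"
proof -
  \<comment> \<open>The place of i after the first two moves. It differs from 2, the place of j, so
    \<open>swap 1 l\<close> leaves 2 alone.\<close>
  define l where "l = swap 1 2 (swap 1 j i)"
  have l: "l \<noteq> 2"
    using assms(1) unfolding l_def
    by (metis transpose_involutory transpose_apply_first transpose_apply_second)
  obtain u1 v1 where 1: "u1 \<noteq> 0" "v1 \<noteq> 0"
    "same_orbit (two i u j v) (two (swap 1 j i) u1 (swap 1 j j) v1)"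
    by (rule same_orbit_move[OF assms(2,3)])
  obtain u2 v2 where 2: "u2 \<noteq> 0" "v2 \<noteq> 0"
    "same_orbit (two (swap 1 j i) u1 1 v1) (two (swap 1 2 (swap 1 j i)) u2 (swap 1 2 1) v2)"
    by (rule same_orbit_move[OF 1(1,2)])
  obtain u3 v3 where 3: "u3 \<noteq> 0" "v3 \<noteq> 0"
    "same_orbit (two l u2 2 v2) (two (swap 1 l l) u3 (swap 1 l 2) v3)"
    by (rule same_orbit_move[OF 2(1,2)])
  have "swap 1 l 2 = 2"
    using l by (simp add: Transposition.transpose_def)
  then have "same_orbit (two l u2 2 v2) (two 1 u3 2 v3)"
    using 3(3) by simp
  moreover have "same_orbit (two (swap 1 j i) u1 1 v1) (two l u2 2 v2)"
    using 2(3) by (simp add: l_def)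
  moreover have "same_orbit (two i u j v) (two (swap 1 j i) u1 1 v1)"
    using 1(3) by simp
  ultimately have "same_orbit (two i u j v) (two 1 u3 2 v3)"
    using same_orbit_trans by blast
  with 3 show thesis using that by blast
qed

lemma same_orbit_symbols:
  assumes "u \<noteq> 0" "v \<noteq> 0"
  shows "same_orbit (two 1 u 2 v) (two 1 ka 2 ka)"
proof -
  have r: "same_orbit (two 1 u 2 v) (two 1 (rot u) 2 (rot' v))" for u v
    using same_orbit_two[OF rotation_in_Aut, of 1 u 2 v] by simp
  have a: "same_orbit (two 1 ka 2 v) (two 1 ka 2 ka)" if "v \<noteq> 0" for v
    using that same_orbit_refl[of "two 1 ka 2 ka"]
      same_orbit_two[OF swap_35_in_Aut, of 1 ka 2 v]
      same_orbit_two[OF swap_36_in_Aut, of 1 ka 2 v]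
    by (cases v) (simp_all add: symbol_apply zero_klein_def Transposition.transpose_def[where 'a = 6])
  have rot'_nz: "rot' v \<noteq> 0" if "v \<noteq> 0" for v
    using that by (cases v) (simp_all add: symbol_apply zero_klein_def)
  \<comment> \<open>One rotation takes c to a, and two take b to a. The second symbol turns the
    other way but stays nonzero, as \<open>a\<close> requires.\<close>
  have c: "same_orbit (two 1 kc 2 v) (two 1 ka 2 ka)" if "v \<noteq> 0" for v
  proof (rule same_orbit_trans)
    show "same_orbit (two 1 kc 2 v) (two 1 ka 2 (rot' v))"
      using r[of kc v] by (simp add: symbol_apply)
  qed (rule a[OF rot'_nz[OF that]])
  have b: "same_orbit (two 1 kb 2 v) (two 1 ka 2 ka)" if "v \<noteq> 0" for v
  proof (rule same_orbit_trans)
    show "same_orbit (two 1 kb 2 v) (two 1 kc 2 (rot' v))"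
      using r[of kb v] by (simp add: symbol_apply)
  qed (rule c[OF rot'_nz[OF that]])
  show ?thesis
    using assms(1) a[OF assms(2)] b[OF assms(2)] c[OF assms(2)]
    by (cases u) (simp_all add: zero_klein_def)
qed

text \<open>One common representative suffices: any two vectors are then linked through it.\<close>

lemma same_orbit_weight_2:
  assumes "weight x = 2"
  shows "same_orbit x (two 1 ka 2 ka)"
proof -
  obtain i u j v where x: "i \<noteq> j" "u \<noteq> 0" "v \<noteq> 0" "x = two i u j v"
    using assms by (rule weight_2E)
  then obtain u' v' where "u' \<noteq> 0" "v' \<noteq> 0" "same_orbit (two i u j v) (two 1 u' 2 v')"
    using same_orbit_support_12 by blast
  then show ?thesis
    using x same_orbit_symbols same_orbit_trans by blast
qed

section \<open>Transitivity as a group action\<close>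

theorem theorem18:
  shows "transitive_action Aut_hexacode {x :: klein ^ 6. weight x = 2}
           (\<lambda>g. restrict (act g) {x. weight x = 2})"
proof -
  let ?E = "{x :: klein ^ 6. weight x = 2}"
  let ?\<phi> = "\<lambda>g. restrict (act g) ?E"
  interpret S: group symG by (rule group_symG)
  have mult: "g \<otimes>\<^bsub>Aut_hexacode\<^esub> h = g \<otimes>\<^bsub>symG\<^esub> h" for g h
    by (simp add: Aut_hexacode_def)
  have Aut: "group Aut_hexacode"
    using subgroup.subgroup_is_group[OF subgroup_Aut_hexacode group_symG]
    by (simp add: Aut_hexacode_def)
  have bij: "?\<phi> g \<in> Bij ?E" if "g \<in> carrier Aut_hexacode" for g
  proof -
    have g: "g \<in> carrier symG" using that by (rule Aut_hexacode_symG)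
    have "act g (act (inv\<^bsub>symG\<^esub> g) x) = x" for x
      using act_inv[OF S.inv_closed[OF g]] g by simp
    then have "bij_betw (act g) ?E ?E"
      using g by (intro bij_betw_byWitness[where f' = "act (inv\<^bsub>symG\<^esub> g)"])
        (auto simp: act_inv act_weight simp del: act.simps)
    then show ?thesis
      by (simp add: Bij_def)
  qed
  have "?\<phi> \<in> hom Aut_hexacode (BijGroup ?E)"
  proof (rule homI)
    fix g h assume gh: "g \<in> carrier Aut_hexacode" "h \<in> carrier Aut_hexacode"
    \<comment> \<open>Restricting loses nothing here: \<open>act h\<close> preserves weight, so its
      values stay where \<open>act g\<close> is kept.\<close>
    then have "?\<phi> (g \<otimes>\<^bsub>symG\<^esub> h) = compose ?E (?\<phi> g) (?\<phi> h)"
      by (auto simp: compose_def fun_eq_iff act_mult act_weight Aut_hexacode_symG simp del: act.simps)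
    then show "?\<phi> (g \<otimes>\<^bsub>Aut_hexacode\<^esub> h) = ?\<phi> g \<otimes>\<^bsub>BijGroup ?E\<^esub> ?\<phi> h"
      using gh bij by (simp add: mult BijGroup_def)
  qed (use bij in \<open>simp add: BijGroup_def\<close>)
  then have "group_action Aut_hexacode ?E ?\<phi>"
    using Aut group_BijGroup
    by (simp add: group_action_def group_hom_def group_hom_axioms_def)
  moreover have "\<exists>g \<in> carrier Aut_hexacode. ?\<phi> g x = y" if "x \<in> ?E" "y \<in> ?E" for x y
    using same_orbit_trans[OF same_orbit_weight_2 same_orbit_sym[OF same_orbit_weight_2], of x y] that
    by (auto simp: same_orbit_def)
  ultimately show ?thesis
    by (simp add: transitive_action_def transitive_action_axioms_def)
qed

end
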